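(* Let $D=\{\zeta\in\mathbb{C}:|\zeta|<1\}$, let $f:D\to\mathbb{C}$ be holomorphic, let $\kappa>0$, and let $L$ be the graph Laplacian of an undirected graph on $N$ nodes. Consider the coupled system $$\dot z_i=f(z_i)-\kappa\,(Lz)_i,\qquad i=1,\dots,N .$$ Let $0<r<1$ and $K=\{z\in\mathbb{C}:|z|\le r\}\subset D$, and suppose $\mathrm{Re}\big(\bar z f(z)\big)\le0$ for all $z$ with $|z|=r$. Then $K^N$ is forward invariant under the coupled system: if $z_i(0)\in K$ for all $i$, then $z_i(t)\in K$ for all $i$ and all $t\ge0$.
   Context: The graph has adjacency matrix $A=[a_{ij}]$ (symmetric with nonnegative entries), degrees $\deg_i=\sum_ja_{ij}$, and Laplacian $L=\operatorname{diag}(\deg_1,\dots,\deg_N)-A$, so that $(Lz)_i=\deg_i z_i-\sum_j a_{ij}z_j$ for $z=(z_1,\dots,z_N)\in\mathbb{C}^N$. *)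

theory Defs
  imports "HOL-Complex_Analysis.Complex_Analysis"
begin

definition degree_matrix :: "real ^ 'n ^ 'n \<Rightarrow> real ^ 'n ^ 'n"
  where "degree_matrix A = (\<chi> i j. if i = j then (\<Sum>k\<in>UNIV. A $ i $ k) else 0)"

definition graph_laplacian :: "real ^ 'n ^ 'n \<Rightarrow> real ^ 'n ^ 'n"
  where "graph_laplacian A = degree_matrix A - A"

definition complex_matrix :: "real ^ 'n ^ 'm \<Rightarrow> complex ^ 'n ^ 'm"
  where "complex_matrix M = (\<chi> i j. complex_of_real (M $ i $ j))"

definition coupled_field ::
    "(complex \<Rightarrow> complex) \<Rightarrow> real \<Rightarrow> real ^ 'n ^ 'n \<Rightarrow> complex ^ 'n \<Rightarrow> complex ^ 'n"
  where "coupled_field f \<kappa> L z =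
    (\<chi> i. f (z $ i) - complex_of_real \<kappa> * (complex_matrix L *v z) $ i)"

definition cartesian_power :: "'a set \<Rightarrow> ('a ^ 'n) set"
  where "cartesian_power S = {z. \<forall>i. z $ i \<in> S}"

text \<open>
  A solution is required to stay in the set \<open>U\<close> on which the vector field \<open>F\<close> is meaningful;
  values of \<open>F\<close> outside \<open>U\<close> are irrelevant. At an endpoint of the time interval \<open>J\<close> the
  derivative is one-sided.
\<close>

definition ode_solution ::
    "('a::real_normed_vector \<Rightarrow> 'a) \<Rightarrow> 'a set \<Rightarrow> real set \<Rightarrow> (real \<Rightarrow> 'a) \<Rightarrow> bool"
  where "ode_solution F U J z \<longleftrightarrow>
    (\<forall>t\<in>J. z t \<in> U \<and> (z has_vector_derivative F (z t)) (at t within J))"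

text \<open>
  Forward invariance of \<open>S\<close> for \<open>z' = F z\<close> on \<open>U\<close>: from every initial state in \<open>S\<close> there is a
  solution for all \<open>t \<ge> 0\<close>, and every solution starting in \<open>S\<close>, on whatever time
  interval it is given (in particular on a bounded one), is in \<open>S\<close> at all its times \<open>t \<ge> 0\<close>.
\<close>

definition forward_invariant ::
    "('a::real_normed_vector \<Rightarrow> 'a) \<Rightarrow> 'a set \<Rightarrow> 'a set \<Rightarrow> bool"
  where "forward_invariant F U S \<longleftrightarrow>
    (\<forall>z0\<in>S. \<exists>z. ode_solution F U {0..} z \<and> z 0 = z0) \<and>
    (\<forall>J z. is_interval J \<longrightarrow> 0 \<in> J \<longrightarrow> ode_solution F U J z \<longrightarrow> z 0 \<in> S \<longrightarrow>
      (\<forall>t\<in>J. 0 \<le> t \<longrightarrow> z t \<in> S))"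

end

theory Submission
  imports Defs
begin

text \<open>
  Why the theorem holds. Measure how far a state is outside the polydisc by the excess energy
  \<open>V z = (\<Sum>i. (max 0 (\<bar>z\<^sub>i\<bar>\<^sup>2 - r\<^sup>2))\<^sup>2)\<close>, which is continuously differentiable and vanishes exactly
  on \<open>K\<^sup>N\<close>. Along a solution, its derivative is \<open>4\<close> times the sum of
  \<open>w\<^sub>i Re (cnj z\<^sub>i * z\<^sub>i')\<close> with the weights \<open>w\<^sub>i = max 0 (\<bar>z\<^sub>i\<bar>\<^sup>2 - r\<^sup>2)\<close>. The two parts of
  the vector field are treated separately.

  The coupling never increases \<open>V\<close>: the weight \<open>w\<^sub>i\<close> is a monotone function of \<open>\<bar>z\<^sub>i\<bar>\<close>, and for
  any nonnegative weight of this kind the Laplacian term is nonnegative, because by the symmetry of the adjacency matrix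
  it is bounded below by half the sum of
  \<open>a\<^sub>i\<^sub>j (w\<^sub>i\<bar>z\<^sub>i\<bar> - w\<^sub>j\<bar>z\<^sub>j\<bar>) (\<bar>z\<^sub>i\<bar> - \<bar>z\<^sub>j\<bar>)\<close> (lemma \<open>laplacian_monotone_weight_nonneg\<close>).

  The node dynamics does not point outwards on the circle \<open>\<bar>z\<bar> = r\<close>, but nothing is known about its
  direction for \<open>\<bar>z\<bar> > r\<close>. A solution on a compact time interval stays in a disc of radius
  \<open>\<rho> < 1\<close>, on which \<open>f\<close> is Lipschitz with some constant \<open>C\<close>; comparing \<open>f z\<close> with
  \<open>f\<close> at the radial projection of \<open>z\<close> gives \<open>Re (cnj z * f z) \<le> C (\<bar>z\<bar>\<^sup>2 - r\<^sup>2)\<close>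
  (lemma \<open>inner_le_of_lipschitz\<close>). Hence \<open>V' \<le> 4 C V\<close>, and a Gronwall argument yields
  \<open>V = 0\<close> for all times if it holds initially (lemma \<open>coupled_solution_stays_in_polydisc\<close>).

  Existence for all times uses the same estimate. Composing \<open>f\<close> with the projection onto the disc
  of radius \<open>r\<close> gives a globally Lipschitz system, which has global solutions
  (lemma \<open>lipschitz_ode_global_solution\<close>). For it the estimate holds with \<open>C = 0\<close>, so a
  solution starting in \<open>K\<^sup>N\<close> never leaves it. On \<open>K\<^sup>N\<close> the two systems agree, so it solves the
  original system as well.
\<close>

section \<open>Global solutions of globally Lipschitz equations\<close>

lemma ode_solution_subset:
  assumes "ode_solution F U J z" "I \<subseteq> J"
  shows "ode_solution F U I z"
  unfolding ode_solution_def
proof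
  fix t assume "t \<in> I"
  then have "z t \<in> U" "(z has_vector_derivative F (z t)) (at t within J)"
    using assms by (auto simp: ode_solution_def)
  then show "z t \<in> U \<and> (z has_vector_derivative F (z t)) (at t within I)"
    using has_vector_derivative_within_subset assms(2) by blast
qed

lemma ode_solution_continuous_on:
  assumes "ode_solution F U J z"
  shows "continuous_on J z"
  unfolding continuous_on_eq_continuous_within
proof
  fix t assume "t \<in> J"
  then have "(z has_vector_derivative F (z t)) (at t within J)"
    using assms by (simp add: ode_solution_def)
  then show "continuous (at t within J) z" by (rule has_vector_derivative_continuous)
qed

text \<open>
  This estimate is what makes the weight \<open>exp (- lam * t)\<close> useful: integration
  costs a factor \<open>1 / lam\<close>, uniformly in the length of the interval.
\<close>

lemma norm_integral_le_exp:
  fixes h :: "real \<Rightarrow> 'a::banach"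
  assumes "lam > 0" "C \<ge> 0" "s \<ge> 0"
    and "continuous_on {0..s} h"
    and "\<And>u. u \<in> {0..s} \<Longrightarrow> norm (h u) \<le> C * exp (lam * u)"
  shows "norm (integral {0..s} h) \<le> C / lam * exp (lam * s)"
proof -
  have "((\<lambda>u. C * exp (lam * u)) has_integral C / lam * exp (lam * s) - C / lam * exp (lam * 0)) {0..s}"
    using assms(1,3) by (intro fundamental_theorem_of_calculus)
      (auto simp flip: has_real_derivative_iff_has_vector_derivative
         intro!: derivative_eq_intros)
  then have int: "(\<lambda>u. C * exp (lam * u)) integrable_on {0..s}"
    and val: "integral {0..s} (\<lambda>u. C * exp (lam * u)) = C / lam * exp (lam * s) - C / lam * exp (lam * 0)"
    by (rule has_integral_integrable, rule integral_unique)
  have "norm (integral {0..s} h) \<le> integral {0..s} (\<lambda>u. C * exp (lam * u))"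
    using assms(4,5)
    by (intro integral_norm_bound_integral int) (auto intro: integrable_continuous_real)
  also have "\<dots> \<le> C / lam * exp (lam * s)"
    unfolding val using assms(1,2) by simp
  finally show ?thesis .
qed

lemma integral_has_vector_derivative_half_line:
  fixes h :: "real \<Rightarrow> 'a::banach"
  assumes "continuous_on {0..} h" "t \<ge> 0"
  shows "((\<lambda>u. integral {0..u} h) has_vector_derivative h t) (at t within {0..})"
proof -
  have "((\<lambda>u. integral {0..u} h) has_vector_derivative h t) (at t within {0..t+1})"
    using assms by (intro integral_has_vector_derivative) (auto intro: continuous_on_subset)
  moreover have "at t within {0..t+1} = at t within {0..}"
    using assms(2) by (intro at_within_nhd[where S = "{..<t+1}"]) auto
  ultimately show ?thesis by simp
qed

text \<open>
  The Picard operator for \<open>z' = F z\<close>, \<open>z 0 = z0\<close>, written for \<open>y t = exp (- lam * t) z t\<close>, so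
  that solutions of at most exponential growth become bounded functions. For negative times
  it is continued by its value at \<open>0\<close>, which makes it act on functions on the whole real line.
\<close>

definition weighted_picard :: "('a::banach \<Rightarrow> 'a) \<Rightarrow> real \<Rightarrow> 'a \<Rightarrow> (real \<Rightarrow> 'a) \<Rightarrow> real \<Rightarrow> 'a"
  where "weighted_picard F lam z0 y t =
    exp (- (lam * max 0 t)) *\<^sub>R
      (z0 + integral {0..max 0 t} (\<lambda>u. F (exp (lam * u) *\<^sub>R y u)))"

text \<open>
  The weighted Picard operator with \<open>lam = L + 1\<close> maps the bounded continuous functions to
  themselves and contracts by the factor \<open>L / (L + 1)\<close> in the supremum norm. Therefore
  Banach's theorem gives the solution on the whole half line at once, and no local solutions
  have to be continued.
\<close>

lemma lipschitz_ode_global_solution: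
  fixes F :: "'a::banach \<Rightarrow> 'a"
  assumes lip: "L-lipschitz_on UNIV F"
  obtains z where "ode_solution F UNIV {0..} z" "z 0 = z0"
proof -
  have L: "L \<ge> 0" using lip by (rule lipschitz_on_nonneg)
  define lam where "lam = L + 1"
  have lam: "lam > 0" using L by (simp add: lam_def)
  have contF: "continuous_on S F" for S
    using lipschitz_on_continuous_on[OF lip] continuous_on_subset by blast
  define h where "h y u = F (exp (lam * u) *\<^sub>R y u)" for y :: "real \<Rightarrow>\<^sub>C 'a" and u
  define Q where "Q y = weighted_picard F lam z0 (apply_bcontfun y)" for y
  have conth: "continuous_on S (h y)" for S y
    unfolding h_def by (rule continuous_on_compose2[OF contF]) (auto intro!: continuous_intros)
  have Q_eq: "Q y t = exp (- (lam * max 0 t)) *\<^sub>R (z0 + integral {0..max 0 t} (h y))" for y t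
    by (simp add: Q_def weighted_picard_def h_def[abs_def])
  have cancel: "exp (- (lam * s)) * (b * exp (lam * s)) = b" for s b
    by (simp add: exp_minus)
  have Qb: "Q y \<in> bcontfun" for y
  proof (rule bcontfun_normI)
    have "continuous_on {0..} (\<lambda>u. integral {0..u} (h y))"
      unfolding continuous_on_eq_continuous_within
      by (auto intro!: has_vector_derivative_continuous
          integral_has_vector_derivative_half_line[OF conth])
    then have "continuous_on UNIV (\<lambda>t. integral {0..max 0 t} (h y))"
      by (rule continuous_on_compose2) (auto intro!: continuous_intros)
    then show "continuous_on UNIV (Q y)"
      unfolding Q_eq by (intro continuous_intros)
  next
    fix t :: real
    let ?s = "max 0 t" and ?C = "norm (F 0) + L * norm y"
    have bd: "norm (h y u) \<le> ?C * exp (lam * u)" if "u \<ge> 0" for u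
    proof -
      have "norm (h y u) \<le> norm (F 0) + norm (h y u - F 0)"
        by (rule norm_triangle_sub)
      also have "norm (h y u - F 0) \<le> L * (exp (lam * u) * norm (y u))"
        using lipschitz_on_normD[OF lip, of "exp (lam * u) *\<^sub>R y u" 0] by (simp add: h_def)
      also have "\<dots> \<le> L * (exp (lam * u) * norm y)"
        using L norm_bounded[of y u] by (intro mult_left_mono) auto
      also have "norm (F 0) \<le> norm (F 0) * exp (lam * u)"
        using lam that by (simp add: mult_le_cancel_left1)
      finally show ?thesis by (simp add: algebra_simps)
    qed
    have "norm (integral {0..?s} (h y)) \<le> ?C / lam * exp (lam * ?s)"
      using lam L bd conth by (intro norm_integral_le_exp) auto
    then have "norm (Q y t) \<le> exp (- (lam * ?s)) * (norm z0 + ?C / lam * exp (lam * ?s))"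
      unfolding Q_eq by (auto intro: order_trans[OF norm_triangle_ineq])
    also have "\<dots> = exp (- (lam * ?s)) * norm z0 + ?C / lam"
      by (simp only: distrib_left cancel)
    also have "\<dots> \<le> norm z0 + ?C / lam"
      using lam by (simp add: mult_left_le_one_le)
    finally show "norm (Q y t) \<le> norm z0 + ?C / lam" .
  qed
  have contraction: "dist (Bcontfun (Q x)) (Bcontfun (Q y)) \<le> L / lam * dist x y" for x y
  proof (rule dist_bound)
    fix t :: real
    let ?s = "max 0 t" and ?C = "L * dist x y"
    have bd: "norm (h x u - h y u) \<le> ?C * exp (lam * u)" for u
    proof -
      have "norm (h x u - h y u) \<le> L * norm (exp (lam * u) *\<^sub>R x u - exp (lam * u) *\<^sub>R y u)"
        unfolding h_def by (rule lipschitz_on_normD[OF lip]) auto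
      also have "\<dots> = L * (exp (lam * u) * dist (x u) (y u))"
        by (simp add: dist_norm flip: scaleR_diff_right)
      also have "\<dots> \<le> L * (exp (lam * u) * dist x y)"
        using L dist_bounded[of x u y] by (intro mult_left_mono) auto
      finally show ?thesis by (simp add: algebra_simps)
    qed
    have "norm (integral {0..?s} (\<lambda>u. h x u - h y u)) \<le> ?C / lam * exp (lam * ?s)"
      using lam L bd conth by (intro norm_integral_le_exp continuous_intros) auto
    also have "integral {0..?s} (\<lambda>u. h x u - h y u) = integral {0..?s} (h x) - integral {0..?s} (h y)"
      by (intro Henstock_Kurzweil_Integration.integral_diff integrable_continuous_real conth)
    finally have le: "norm (integral {0..?s} (h x) - integral {0..?s} (h y)) \<le> ?C / lam * exp (lam * ?s)" .
    have "dist (Q x t) (Q y t) = exp (- (lam * ?s)) * norm (integral {0..?s} (h x) - integral {0..?s} (h y))"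
      by (simp add: Q_eq dist_norm flip: scaleR_diff_right)
    also have "\<dots> \<le> exp (- (lam * ?s)) * (?C / lam * exp (lam * ?s))"
      using le by (intro mult_left_mono) auto
    also have "\<dots> = L / lam * dist x y" by (simp only: cancel) simp
    finally show "dist (Bcontfun (Q x) t) (Bcontfun (Q y) t) \<le> L / lam * dist x y"
      by (simp add: Bcontfun_inverse Qb)
  qed
  have "\<exists>!y. Bcontfun (Q y) = y"
    by (rule banach_fix_type[of "L / lam"]) (use L contraction in \<open>auto simp: lam_def\<close>)
  then obtain y where "Bcontfun (Q y) = y" by auto
  then have y: "y t = Q y t" for t
    using Bcontfun_inverse[OF Qb[of y]] by metis
  \<comment> \<open>undo the weight: the fixed point equation says \<open>exp (lam * t) y t = z t\<close>\<close>
  define z where "z t = z0 + integral {0..t} (h y)" for t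
  have hz: "h y t = F (z t)" if "t \<ge> 0" for t
    using that y[of t] by (simp add: h_def Q_eq z_def exp_minus)
  have "(z has_vector_derivative F (z t)) (at t within {0..})" if "t \<ge> 0" for t
  proof -
    have "(z has_vector_derivative 0 + h y t) (at t within {0..})"
      unfolding z_def[abs_def]
      by (intro has_vector_derivative_add has_vector_derivative_const
            integral_has_vector_derivative_half_line conth that)
    then show ?thesis using hz[OF that] by simp
  qed
  then have "ode_solution F UNIV {0..} z" by (simp add: ode_solution_def)
  moreover have "z 0 = z0" by (simp add: z_def)
  ultimately show ?thesis by (rule that)
qed

section \<open>The Laplacian against a monotone weight\<close>

text \<open>
  The degree in the Laplacian turns the coupling into a sum of differences, so
  that only the relative position of neighbours matters.
\<close>

lemma coupled_field_graph_laplacian_nth: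
  "coupled_field f \<kappa> (graph_laplacian A) z $ i =
    f (z $ i) - of_real \<kappa> * (\<Sum>j\<in>UNIV. of_real (A $ i $ j) * (z $ i - z $ j))"
proof -
  have "(\<Sum>j\<in>UNIV. complex_of_real (degree_matrix A $ i $ j) * z $ j) =
      (\<Sum>j\<in>UNIV. if j = i then complex_of_real (\<Sum>k\<in>UNIV. A $ i $ k) * z $ i else 0)"
    by (rule sum.cong) (auto simp: degree_matrix_def)
  then have "(complex_matrix (graph_laplacian A) *v z) $ i =
      (\<Sum>j\<in>UNIV. of_real (A $ i $ j) * (z $ i - z $ j))"
    by (simp add: complex_matrix_def matrix_vector_mult_def graph_laplacian_def
        left_diff_distrib right_diff_distrib sum_subtractf sum_distrib_right)
  then show ?thesis by (simp add: coupled_field_def)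
qed

text \<open>
  By Cauchy-Schwarz, \<open>z\<^sub>i \<bullet> (z\<^sub>i - z\<^sub>j) \<ge> \<bar>z\<^sub>i\<bar> (\<bar>z\<^sub>i\<bar> - \<bar>z\<^sub>j\<bar>)\<close>, which reduces the claim to the
  moduli. There, averaging the double sum with its transpose leaves the terms
  \<open>(p\<^sub>i - p\<^sub>j) (\<bar>z\<^sub>i\<bar> - \<bar>z\<^sub>j\<bar>)\<close>, where \<open>p\<^sub>i = w \<bar>z\<^sub>i\<bar> * \<bar>z\<^sub>i\<bar>\<close> is increasing in \<open>\<bar>z\<^sub>i\<bar>\<close>, so both
  factors have the same sign.
\<close>

lemma laplacian_monotone_weight_nonneg:
  fixes z :: "'n::finite \<Rightarrow> 'a::real_inner" and A :: "real ^ 'n ^ 'n"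
  assumes sym: "\<And>i j. A $ i $ j = A $ j $ i"
    and nonneg: "\<And>i j. A $ i $ j \<ge> 0"
    and w0: "\<And>s. s \<ge> 0 \<Longrightarrow> w s \<ge> 0"
    and mono: "mono_on {0..} w"
  shows "(\<Sum>i\<in>UNIV. w (norm (z i)) * (z i \<bullet> (\<Sum>j\<in>UNIV. A $ i $ j *\<^sub>R (z i - z j)))) \<ge> 0"
proof -
  let ?m = "\<lambda>i. norm (z i)"
  let ?p = "\<lambda>i. w (?m i) * ?m i"
  define S where "S = (\<Sum>i\<in>UNIV. \<Sum>j\<in>UNIV. A $ i $ j * (?p i * (?m i - ?m j)))"
  have S': "S = (\<Sum>i\<in>UNIV. \<Sum>j\<in>UNIV. A $ i $ j * (?p j * (?m j - ?m i)))"
    unfolding S_def by (subst sum.swap) (simp add: sym)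
  have pos: "(?p i - ?p j) * (?m i - ?m j) \<ge> 0" for i j
  proof -
    have mono_p: "w a * a \<le> w b * b" if "0 \<le> a" "a \<le> b" for a b
      using that w0 mono by (intro mult_mono) (auto simp: mono_on_def)
    show ?thesis
      using mono_p[of "?m i" "?m j"] mono_p[of "?m j" "?m i"]
      by (cases "?m i \<le> ?m j") (auto simp: mult_nonpos_nonpos)
  qed
  have "2 * S = (\<Sum>i\<in>UNIV. \<Sum>j\<in>UNIV. A $ i $ j * ((?p i - ?p j) * (?m i - ?m j)))"
    unfolding mult_2 by (subst (2) S', unfold S_def) (simp add: algebra_simps flip: sum.distrib)
  also have "\<dots> \<ge> 0"
    by (intro sum_nonneg mult_nonneg_nonneg nonneg pos)
  finally have "S \<ge> 0" by simp
  also have "S \<le> (\<Sum>i\<in>UNIV. w (?m i) * (z i \<bullet> (\<Sum>j\<in>UNIV. A $ i $ j *\<^sub>R (z i - z j))))"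
    unfolding S_def inner_sum_right sum_distrib_left
  proof (intro sum_mono)
    fix i j
    have "?m i * (?m i - ?m j) \<le> z i \<bullet> (z i - z j)"
      using norm_cauchy_schwarz[of "z i" "z j"]
      by (simp add: inner_diff_right right_diff_distrib power2_eq_square flip: power2_norm_eq_inner)
    then have "A $ i $ j * (w (?m i) * (?m i * (?m i - ?m j))) \<le> A $ i $ j * (w (?m i) * (z i \<bullet> (z i - z j)))"
      by (intro mult_left_mono nonneg w0) auto
    then show "A $ i $ j * (?p i * (?m i - ?m j)) \<le> w (?m i) * (z i \<bullet> (A $ i $ j *\<^sub>R (z i - z j)))"
      by (simp add: algebra_simps)
  qed
  finally show ?thesis .
qed

section \<open>The excess energy\<close>

lemma has_real_derivative_positive_part_square:
  "((\<lambda>s::real. (max 0 s)\<^sup>2) has_real_derivative 2 * max 0 s) (at s)"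
proof -
  consider "s < 0" | "s = 0" | "s > 0" by linarith
  then show ?thesis
  proof cases
    case 1
    have "((\<lambda>s::real. 0) has_real_derivative 2 * max 0 s) (at s)" using 1 by simp
    then show ?thesis
      by (rule has_field_derivative_transform_within_open[where S = "{..<0}"]) (use 1 in auto)
  next
    case 3
    have "((\<lambda>s::real. s\<^sup>2) has_real_derivative 2 * max 0 s) (at s)"
      using 3 by (auto intro!: derivative_eq_intros)
    then show ?thesis
      by (rule has_field_derivative_transform_within_open[where S = "{0<..}"]) (use 3 in auto)
  next
    case 2
    have "((\<lambda>h::real. (max 0 h)\<^sup>2 / h) \<longlongrightarrow> 0) (at 0)"
    proof (rule tendsto_sandwich[where f = "\<lambda>h. - \<bar>h\<bar>" and h = "\<lambda>h. \<bar>h\<bar>"])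
      have "(max 0 h)\<^sup>2 / h = max 0 h" for h :: real
        by (auto simp: max_def power2_eq_square)
      then show "\<forall>\<^sub>F h::real in at 0. - \<bar>h\<bar> \<le> (max 0 h)\<^sup>2 / h"
        "\<forall>\<^sub>F h::real in at 0. (max 0 h)\<^sup>2 / h \<le> \<bar>h\<bar>"
        by (auto intro!: always_eventually)
    qed (auto intro!: tendsto_eq_intros)
    then show ?thesis using 2 by (simp add: DERIV_def)
  qed
qed

text \<open>
  The outer square makes the function differentiable also where some \<open>\<bar>z\<^sub>i\<bar> = r\<close>; the maximum of
  the moduli, the more obvious measure of distance from the polydisc, is not.
\<close>

definition excess_energy :: "real \<Rightarrow> complex ^ 'n \<Rightarrow> real"
  where "excess_energy r z = (\<Sum>i\<in>UNIV. (max 0 ((cmod (z $ i))\<^sup>2 - r\<^sup>2))\<^sup>2)"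

lemma excess_energy_nonneg: "excess_energy r z \<ge> 0"
  by (simp add: excess_energy_def sum_nonneg)

lemma excess_energy_eq_0_iff:
  assumes "r \<ge> 0"
  shows "excess_energy r z = 0 \<longleftrightarrow> z \<in> cartesian_power (cball 0 r)"
proof -
  have "max 0 (s\<^sup>2 - r\<^sup>2) = 0 \<longleftrightarrow> s \<le> r" if "s \<ge> 0" for s :: real
    using power_mono_iff[OF that assms, of 2] by (auto simp: max_def)
  then show ?thesis
    by (simp add: excess_energy_def cartesian_power_def sum_nonneg_eq_0_iff)
qed

lemma excess_energy_derivative:
  fixes z :: "real \<Rightarrow> complex ^ 'n"
  assumes "(z has_vector_derivative z') (at t)"
  shows "((\<lambda>t. excess_energy r (z t)) has_real_derivative
    4 * (\<Sum>i\<in>UNIV. max 0 ((cmod (z t $ i))\<^sup>2 - r\<^sup>2) * (z t $ i \<bullet> z' $ i))) (at t)"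
proof -
  have "((\<lambda>t. (max 0 ((cmod (z t $ i))\<^sup>2 - r\<^sup>2))\<^sup>2) has_real_derivative
      2 * max 0 ((cmod (z t $ i))\<^sup>2 - r\<^sup>2) * (2 * (z t $ i \<bullet> z' $ i))) (at t)" for i
  proof -
    have "((\<lambda>t. z t $ i) has_vector_derivative z' $ i) (at t)"
      by (rule bounded_linear.has_vector_derivative[OF bounded_linear_vec_nth assms])
    then have d: "((\<lambda>t. z t $ i) has_derivative (\<lambda>h. h *\<^sub>R z' $ i)) (at t)"
      by (simp add: has_vector_derivative_def)
    have "((\<lambda>t. (cmod (z t $ i))\<^sup>2 - r\<^sup>2) has_real_derivative 2 * (z t $ i \<bullet> z' $ i)) (at t)"
      unfolding power2_norm_eq_inner has_field_derivative_def
      by (rule derivative_eq_intros d refl | simp add: fun_eq_iff inner_commute)+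
    from DERIV_chain2[OF has_real_derivative_positive_part_square this] show ?thesis .
  qed
  then have "((\<lambda>t. excess_energy r (z t)) has_real_derivative
      (\<Sum>i\<in>UNIV. 2 * max 0 ((cmod (z t $ i))\<^sup>2 - r\<^sup>2) * (2 * (z t $ i \<bullet> z' $ i)))) (at t)"
    unfolding excess_energy_def by (intro DERIV_sum)
  then show ?thesis by (simp add: sum_distrib_left mult_ac)
qed

text \<open>
  The left side is a quarter of the derivative of the excess energy along a solution. The weights
  are monotone in the moduli, so the coupling only helps, and each node contributes at most
  \<open>C\<close> times its own share of the energy.
\<close>

lemma excess_energy_dissipation:
  fixes A :: "real ^ 'n ^ 'n" and z :: "complex ^ 'n"
  assumes "\<And>i j. A $ i $ j = A $ j $ i" "\<And>i j. A $ i $ j \<ge> 0" "\<kappa> \<ge> 0" "r \<ge> 0"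
    and growth: "\<And>i. cmod (z $ i) > r \<Longrightarrow> z $ i \<bullet> g (z $ i) \<le> C * ((cmod (z $ i))\<^sup>2 - r\<^sup>2)"
  shows "(\<Sum>i\<in>UNIV. max 0 ((cmod (z $ i))\<^sup>2 - r\<^sup>2) *
           (z $ i \<bullet> coupled_field g \<kappa> (graph_laplacian A) z $ i)) \<le> C * excess_energy r z"
proof -
  define w where "w s = max 0 (s\<^sup>2 - r\<^sup>2)" for s :: real
  let ?D = "\<lambda>i. \<Sum>j\<in>UNIV. A $ i $ j *\<^sub>R (z $ i - z $ j)"
  have eq: "z $ i \<bullet> coupled_field g \<kappa> (graph_laplacian A) z $ i
      = z $ i \<bullet> g (z $ i) - \<kappa> * (z $ i \<bullet> ?D i)" for i
    by (simp add: coupled_field_graph_laplacian_nth inner_diff_right flip: scaleR_conv_of_real)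
  have w0: "w s \<ge> 0" for s by (simp add: w_def)
  have "mono_on {0..} w"
    unfolding w_def by (intro mono_onI max.mono diff_right_mono power_mono) auto
  then have lap: "(\<Sum>i\<in>UNIV. w (cmod (z $ i)) * (z $ i \<bullet> ?D i)) \<ge> 0"
    by (intro laplacian_monotone_weight_nonneg assms(1,2) w0)
  have loc: "w (cmod (z $ i)) * (z $ i \<bullet> g (z $ i)) \<le> C * (w (cmod (z $ i)))\<^sup>2" for i
  proof (cases "cmod (z $ i) > r")
    case True
    then have "r\<^sup>2 \<le> (cmod (z $ i))\<^sup>2" using assms(4) by (intro power_mono) auto
    then have "w (cmod (z $ i)) = (cmod (z $ i))\<^sup>2 - r\<^sup>2" by (simp add: w_def)
    then show ?thesis
      using mult_left_mono[OF growth[OF True] w0]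
      by (metis mult.left_commute power2_eq_square)
  next
    case False
    then have "(cmod (z $ i))\<^sup>2 \<le> r\<^sup>2" by (intro power_mono) auto
    then show ?thesis by (simp add: w_def)
  qed
  have "(\<Sum>i\<in>UNIV. w (cmod (z $ i)) * (z $ i \<bullet> coupled_field g \<kappa> (graph_laplacian A) z $ i))
      = (\<Sum>i\<in>UNIV. w (cmod (z $ i)) * (z $ i \<bullet> g (z $ i)))
        - \<kappa> * (\<Sum>i\<in>UNIV. w (cmod (z $ i)) * (z $ i \<bullet> ?D i))"
    unfolding eq by (simp only: right_diff_distrib sum_subtractf sum_distrib_left mult.left_commute)
  also have "\<dots> \<le> (\<Sum>i\<in>UNIV. w (cmod (z $ i)) * (z $ i \<bullet> g (z $ i)))"
    using lap assms(3) by simp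
  also have "\<dots> \<le> (\<Sum>i\<in>UNIV. C * (w (cmod (z $ i)))\<^sup>2)"
    by (intro sum_mono loc)
  also have "\<dots> = C * excess_energy r z"
    by (simp add: excess_energy_def w_def sum_distrib_left)
  finally show ?thesis by (simp add: w_def)
qed

text \<open>
  Gronwall's argument: by \<open>V' \<le> 4 C V\<close> the function \<open>exp (- 4 C t) V t\<close> is nonincreasing. It
  starts at \<open>0\<close> and is never negative. The growth bound is required only along the
  given solution, since for the original \<open>f\<close> the constant depends on how close this solution
  comes to the unit circle.
\<close>

lemma coupled_solution_stays_in_polydisc:
  fixes A :: "real ^ 'n ^ 'n" and z :: "real \<Rightarrow> complex ^ 'n"
  assumes A: "\<And>i j. A $ i $ j = A $ j $ i" "\<And>i j. A $ i $ j \<ge> 0" and "\<kappa> \<ge> 0" "r \<ge> 0"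
    and sol: "ode_solution (coupled_field g \<kappa> (graph_laplacian A)) U {0..T} z"
    and growth: "\<And>t i. t \<in> {0..T} \<Longrightarrow> cmod (z t $ i) > r \<Longrightarrow>
       z t $ i \<bullet> g (z t $ i) \<le> C * ((cmod (z t $ i))\<^sup>2 - r\<^sup>2)"
    and "z 0 \<in> cartesian_power (cball 0 r)" "T \<ge> 0"
  shows "z T \<in> cartesian_power (cball 0 r)"
proof (cases "T = 0")
  case False
  then have T: "0 < T" using assms by simp
  define V where "V t = excess_energy r (z t)" for t
  let ?W = "\<lambda>t. exp (- (4 * C * t)) * V t"
  have contz: "continuous_on {0..T} z"
    using sol by (rule ode_solution_continuous_on)
  have "?W T \<le> ?W 0"
  proof (rule DERIV_nonpos_imp_decreasing_open[OF less_imp_le[OF T]])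
    fix t assume t: "0 < t" "t < T"
    then have dz: "(z has_vector_derivative coupled_field g \<kappa> (graph_laplacian A) (z t)) (at t)"
      using sol by (simp add: ode_solution_def flip: at_within_Icc_at[OF t])
    define D where "D = (\<Sum>i\<in>UNIV. max 0 ((cmod (z t $ i))\<^sup>2 - r\<^sup>2) *
       (z t $ i \<bullet> coupled_field g \<kappa> (graph_laplacian A) (z t) $ i))"
    have dV: "(V has_real_derivative 4 * D) (at t)"
      unfolding V_def[abs_def] D_def by (rule excess_energy_derivative[OF dz])
    have "D \<le> C * V t"
      unfolding D_def V_def using t
      by (intro excess_energy_dissipation assms growth) auto
    moreover have "(?W has_real_derivative exp (- (4 * C * t)) * (4 * (D - C * V t))) (at t)"
      by (rule derivative_eq_intros dV refl | simp add: algebra_simps)+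
    ultimately show "\<exists>y. (?W has_real_derivative y) (at t) \<and> y \<le> 0"
      by (meson exp_ge_zero mult_nonneg_nonpos diff_le_0_iff_le zero_le_numeral)
  next
    show "continuous_on {0..T} ?W"
      unfolding V_def excess_energy_def by (intro continuous_intros contz)
  qed
  also have "V 0 = 0"
    using assms by (simp add: V_def excess_energy_eq_0_iff)
  finally have "V T \<le> 0" by (simp add: mult_le_0_iff)
  then have "V T = 0" using excess_energy_nonneg[of r "z T"] by (simp add: V_def)
  then show ?thesis using assms by (simp add: V_def excess_energy_eq_0_iff)
qed (use assms in simp)

section \<open>Lipschitz bounds and radial projection\<close>

lemma holomorphic_lipschitz_on_cball:
  assumes "f holomorphic_on ball 0 R" "\<rho> < R"
  obtains C where "C-lipschitz_on (cball 0 \<rho>) f"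
proof -
  have sub: "cball 0 \<rho> \<subseteq> ball (0::complex) R" using assms(2) by auto
  have "continuous_on (cball 0 \<rho>) (deriv f)"
    using holomorphic_on_imp_continuous_on[OF holomorphic_deriv[OF assms(1) open_ball]] sub
    by (rule continuous_on_subset)
  then have "bounded (deriv f ` cball 0 \<rho>)"
    by (intro compact_imp_bounded compact_continuous_image compact_cball)
  then obtain C where C: "C > 0" "\<And>x. x \<in> cball 0 \<rho> \<Longrightarrow> norm (deriv f x) \<le> C"
    by (auto simp: bounded_pos)
  have "C-lipschitz_on (cball 0 \<rho>) f"
  proof (rule lipschitz_onI)
    fix x y :: complex assume xy: "x \<in> cball 0 \<rho>" "y \<in> cball 0 \<rho>"
    have "norm (f x - f y) \<le> C * norm (x - y)"
      using xy sub C holomorphic_derivI[OF assms(1) open_ball]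
      by (intro field_differentiable_bound[of "cball 0 \<rho>" f "deriv f"]) (auto simp del: mem_cball)
    then show "dist (f x) (f y) \<le> C * dist x y" by (simp add: dist_norm)
  qed (use C in simp)
  then show ?thesis by (rule that)
qed

lemma coupled_field_lipschitz:
  fixes L :: "real ^ 'n ^ 'n"
  assumes "C-lipschitz_on UNIV g"
  obtains B where "B-lipschitz_on UNIV (coupled_field g \<kappa> L)"
proof -
  have C: "C \<ge> 0" using assms by (rule lipschitz_on_nonneg)
  have "bounded_linear ((*v) (complex_matrix L))" 
    by (rule matrix_vector_mul_bounded_linear)
  then obtain M where M: "\<And>x. norm (complex_matrix L *v x) \<le> M * norm x" "M > 0"
    by (metis bounded_linear.pos_bounded mult.commute)
  have nth: "norm (coupled_field g \<kappa> L x $ i - coupled_field g \<kappa> L y $ i)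
     \<le> (C + \<bar>\<kappa>\<bar> * M) * norm (x - y)" for x y i
  proof -
    have "coupled_field g \<kappa> L x $ i - coupled_field g \<kappa> L y $ i =
       (g (x $ i) - g (y $ i)) - of_real \<kappa> * (complex_matrix L *v (x - y)) $ i"
      by (simp add: coupled_field_def matrix_vector_mult_diff_distrib algebra_simps)
    also have "norm \<dots> \<le> norm (g (x $ i) - g (y $ i)) + norm (of_real \<kappa> * (complex_matrix L *v (x - y)) $ i)"
      by (rule norm_triangle_ineq4)
    also have "norm (g (x $ i) - g (y $ i)) \<le> C * norm (x $ i - y $ i)"
      by (rule lipschitz_on_normD[OF assms]) auto
    also have "\<dots> \<le> C * norm (x - y)"
      using C Finite_Cartesian_Product.norm_nth_le[of "x - y" i] by (intro mult_left_mono) auto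
    also have "norm (of_real \<kappa> * (complex_matrix L *v (x - y)) $ i) \<le> \<bar>\<kappa>\<bar> * (M * norm (x - y))"
      using order_trans[OF Finite_Cartesian_Product.norm_nth_le M(1)]
      by (auto simp: norm_mult intro!: mult_left_mono)
    finally show ?thesis by (simp add: algebra_simps)
  qed
  have "(real CARD('n) * (C + \<bar>\<kappa>\<bar> * M))-lipschitz_on UNIV (coupled_field g \<kappa> L)"
  proof (rule lipschitz_onI)
    fix x y
    have "norm (coupled_field g \<kappa> L x - coupled_field g \<kappa> L y)
       \<le> (\<Sum>i\<in>UNIV. norm ((coupled_field g \<kappa> L x - coupled_field g \<kappa> L y) $ i))"
      unfolding norm_vec_def by (rule L2_set_le_sum) simp
    also have "\<dots> \<le> (\<Sum>i\<in>(UNIV::'n set). (C + \<bar>\<kappa>\<bar> * M) * norm (x - y))"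
      by (intro sum_mono) (simp add: nth)
    finally show "dist (coupled_field g \<kappa> L x) (coupled_field g \<kappa> L y)
        \<le> real CARD('n) * (C + \<bar>\<kappa>\<bar> * M) * dist x y"
      by (simp add: dist_norm)
  qed (use C M in simp)
  then show ?thesis by (rule that)
qed

lemma closest_point_cball_outside:
  fixes z :: "'a::euclidean_space"
  assumes "0 < r" "r \<le> norm z"
  shows "closest_point (cball 0 r) z = (r / norm z) *\<^sub>R z" (is ?point)
    and "norm (z - closest_point (cball 0 r) z) = norm z - r" (is ?distance)
proof -
  have nz: "norm z > 0" using assms by linarith
  have "z - (r / norm z) *\<^sub>R z = (1 - r / norm z) *\<^sub>R z" by (simp add: scaleR_diff_left)
  then have "dist z ((r / norm z) *\<^sub>R z) = \<bar>1 - r / norm z\<bar> * norm z"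
    by (simp add: dist_norm)
  also have "\<dots> = norm z - r" using assms nz by (simp add: field_simps)
  finally have d: "dist z ((r / norm z) *\<^sub>R z) = norm z - r" .
  have "norm z - r \<le> dist z y" if "y \<in> cball 0 r" for y
    using that norm_triangle_ineq2[of z y] by (simp add: dist_norm)
  then show ?point
    using assms nz d by (intro closest_point_unique[symmetric]) auto
  then show ?distance using d by (simp add: dist_norm)
qed

text \<open>
  The projection of \<open>z\<close> is a positive multiple of \<open>z\<close> on the boundary circle, so the sign
  condition there carries over to all points outside.
\<close>

lemma inner_closest_point_nonpos:
  assumes "0 < r" "r < cmod z" "\<And>z. cmod z = r \<Longrightarrow> z \<bullet> f z \<le> 0"
  shows "z \<bullet> f (closest_point (cball 0 r) z) \<le> 0"
proof -
  let ?p = "(r / cmod z) *\<^sub>R z"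
  have nz: "cmod z > 0" using assms by linarith
  have p: "closest_point (cball 0 r) z = ?p"
    using assms by (intro closest_point_cball_outside) auto
  have "cmod ?p = r" using nz assms by simp
  then have "?p \<bullet> f ?p \<le> 0" by (rule assms(3))
  then have "(r / cmod z) * (z \<bullet> f ?p) \<le> 0" by (simp only: inner_scaleR_left)
  moreover have "r / cmod z > 0" using assms nz by simp
  ultimately have "z \<bullet> f ?p \<le> 0" using mult_pos_pos not_le by blast
  then show ?thesis by (simp only: p)
qed

text \<open>
  Let \<open>p\<close> be the projection of \<open>z\<close>. Since \<open>z \<bullet> f p \<le> 0\<close> and \<open>\<bar>z - p\<bar> = \<bar>z\<bar> - r\<close>, the inner
  product is at most \<open>C \<bar>z\<bar> (\<bar>z\<bar> - r)\<close>, and \<open>\<bar>z\<bar> \<le> \<bar>z\<bar> + r\<close>.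
\<close>

lemma inner_le_of_lipschitz:
  assumes "0 < r" "C-lipschitz_on (cball 0 \<rho>) f" "r < cmod z" "cmod z \<le> \<rho>"
    and bdry: "\<And>z. cmod z = r \<Longrightarrow> z \<bullet> f z \<le> 0"
  shows "z \<bullet> f z \<le> C * ((cmod z)\<^sup>2 - r\<^sup>2)"
proof -
  let ?p = "closest_point (cball 0 r) z"
  have C: "C \<ge> 0" using assms(2) by (rule lipschitz_on_nonneg)
  have d: "cmod (z - ?p) = cmod z - r"
    using assms by (intro closest_point_cball_outside) auto
  have "?p \<in> cball 0 r"
    using assms(1) by (intro closest_point_in_set) auto
  then have "?p \<in> cball 0 \<rho>" using assms(3,4) by simp
  have "z \<bullet> f z = z \<bullet> f ?p + z \<bullet> (f z - f ?p)" by (simp add: inner_diff_right)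
  also have "\<dots> \<le> 0 + cmod z * cmod (f z - f ?p)"
    using inner_closest_point_nonpos[OF assms(1,3) bdry] by (intro add_mono norm_cauchy_schwarz) auto
  also have "\<dots> \<le> cmod z * (C * (cmod z - r))"
    using lipschitz_on_normD[OF assms(2), of z ?p] \<open>?p \<in> cball 0 \<rho>\<close> assms(4) d
    by (auto intro!: mult_left_mono)
  also have "\<dots> \<le> (cmod z + r) * (C * (cmod z - r))"
    using assms C by (intro mult_right_mono) auto
  also have "\<dots> = C * ((cmod z)\<^sup>2 - r\<^sup>2)" by (simp add: power2_eq_square algebra_simps)
  finally show ?thesis .
qed

theorem lemma5:
  fixes f :: "complex \<Rightarrow> complex" and \<kappa> r :: real and A :: "real ^ 'n ^ 'n"
  assumes "f holomorphic_on ball 0 1"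
    and "\<kappa> > 0"
    and "\<And>i j. A $ i $ j = A $ j $ i"
    and "\<And>i j. A $ i $ j \<ge> 0"
    and "0 < r" and "r < 1"
    and "\<And>z. cmod z = r \<Longrightarrow> Re (cnj z * f z) \<le> 0"
  shows "forward_invariant (coupled_field f \<kappa> (graph_laplacian A))
           (cartesian_power (ball 0 1)) (cartesian_power (cball 0 r))"
proof -
  let ?F = "\<lambda>g. coupled_field g \<kappa> (graph_laplacian A)"
  let ?K = "cartesian_power (cball 0 r) :: (complex ^ 'n) set"
  have bdry: "z \<bullet> f z \<le> 0" if "cmod z = r" for z
    using assms(7)[OF that] by (simp add: inner_complex_def)
  have "\<exists>z. ode_solution (?F f) (cartesian_power (ball 0 1)) {0..} z \<and> z 0 = z0"
    if "z0 \<in> ?K" for z0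
  proof -
    \<comment> \<open>\<open>f \<circ> ?P\<close> is globally Lipschitz and agrees with \<open>f\<close> on the disc of radius \<open>r\<close>\<close>
    let ?P = "closest_point (cball (0::complex) r)"
    let ?g = "\<lambda>z. f (?P z)"
    obtain C where C: "C-lipschitz_on (cball 0 r) f"
      using holomorphic_lipschitz_on_cball[OF assms(1,6)] .
    have ne: "cball (0::complex) r \<noteq> {}" using assms(5) by simp
    have "1-lipschitz_on UNIV ?P"
      using closest_point_lipschitz[OF convex_cball closed_cball ne] by (auto intro: lipschitz_onI)
    moreover have "range ?P \<subseteq> cball 0 r"
      using closest_point_in_set[OF closed_cball ne] by blast
    ultimately have "(C * 1)-lipschitz_on UNIV ?g"
      using lipschitz_on_subset[OF C] by (intro lipschitz_on_compose2)
    then obtain B where "B-lipschitz_on UNIV (?F ?g)"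
      by (rule coupled_field_lipschitz)
    then obtain z where z: "ode_solution (?F ?g) UNIV {0..} z" "z 0 = z0"
      by (rule lipschitz_ode_global_solution)
    have K: "z t \<in> ?K" if "t \<ge> 0" for t
    proof (rule coupled_solution_stays_in_polydisc)
      show "ode_solution (?F ?g) UNIV {0..t} z"
        using z(1) by (rule ode_solution_subset) auto
      show "z s $ i \<bullet> ?g (z s $ i) \<le> 0 * ((cmod (z s $ i))\<^sup>2 - r\<^sup>2)"
        if "cmod (z s $ i) > r" for s i
        using inner_closest_point_nonpos[OF assms(5) that bdry] by simp
    qed (use assms z \<open>z0 \<in> ?K\<close> that in auto)
    have "?F ?g x = ?F f x" if "x \<in> ?K" for x
      using that by (simp add: coupled_field_def cartesian_power_def closest_point_self vec_eq_iff)
    moreover have "?K \<subseteq> cartesian_power (ball 0 1)"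
      using assms(6) by (auto simp: cartesian_power_def intro: le_less_trans)
    ultimately have "ode_solution (?F f) (cartesian_power (ball 0 1)) {0..} z"
      using z(1) K by (auto simp: ode_solution_def)
    then show ?thesis using z(2) by blast
  qed
  moreover have "z t \<in> ?K"
    if J: "is_interval J" "0 \<in> J" "t \<in> J" "0 \<le> t" and z0: "z 0 \<in> ?K"
      and sol: "ode_solution (?F f) (cartesian_power (ball 0 1)) J z" for J z t
  proof -
    have sub: "{0..t} \<subseteq> J"
      using mem_is_interval_1_I[OF J(1,2,3)] by auto
    then have solt: "ode_solution (?F f) (cartesian_power (ball 0 1)) {0..t} z"
      using sol by (rule ode_solution_subset[rotated])
    then have contz: "continuous_on {0..t} z"
      by (rule ode_solution_continuous_on)
    \<comment> \<open>compactness of \<open>{0..t}\<close> keeps the solution uniformly away from the unit circle\<close>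
    have "\<exists>\<rho>i<1. \<forall>s\<in>{0..t}. cmod (z s $ i) \<le> \<rho>i" for i
    proof -
      have "continuous_on {0..t} (\<lambda>s. cmod (z s $ i))" by (intro continuous_intros contz)
      then obtain s where s: "s \<in> {0..t}" "\<And>u. u \<in> {0..t} \<Longrightarrow> cmod (z u $ i) \<le> cmod (z s $ i)"
        using continuous_attains_sup[of "{0..t}" "\<lambda>s. cmod (z s $ i)"] J(4) by auto
      moreover have "cmod (z s $ i) < 1"
        using solt s(1) by (auto simp: ode_solution_def cartesian_power_def)
      ultimately show ?thesis by blast
    qed
    then obtain \<rho>i where \<rho>i: "\<And>i. \<rho>i i < 1" "\<And>i s. s \<in> {0..t} \<Longrightarrow> cmod (z s $ i) \<le> \<rho>i i"
      by metis
    define \<rho> where "\<rho> = Max (range \<rho>i)"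
    have \<rho>: "\<rho> < 1" "\<And>i s. s \<in> {0..t} \<Longrightarrow> cmod (z s $ i) \<le> \<rho>"
      unfolding \<rho>_def using \<rho>i by (auto intro!: order_trans[OF \<rho>i(2) Max_ge])
    obtain C where C: "C-lipschitz_on (cball 0 \<rho>) f"
      using holomorphic_lipschitz_on_cball[OF assms(1) \<rho>(1)] .
    show ?thesis
    proof (rule coupled_solution_stays_in_polydisc[OF _ _ _ _ solt])
      show "z s $ i \<bullet> f (z s $ i) \<le> C * ((cmod (z s $ i))\<^sup>2 - r\<^sup>2)"
        if "s \<in> {0..t}" "cmod (z s $ i) > r" for s i
        using inner_le_of_lipschitz[OF assms(5) C that(2) \<rho>(2)[OF that(1)] bdry] .
    qed (use assms z0 J in auto)
  qed
  ultimately show ?thesis unfolding forward_invariant_def by blast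
qed

end
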